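(* Let $-1\le B<A\le 1$ and $f\in\mathcal{C}(A,B)$. (i) If $(A,B)\in E_1\cup E_2$, then $$\|S_f\|\le\begin{cases}2, & B=-1,\\ A-B, & B\ne-1,\ |A+B|\le 2(1-B^2),\\ (A-B)\gamma(\alpha), & B\ne -1,\ |A+B|>2(1-B^2),\end{cases}$$ where $\gamma(t)=\dfrac{(1-t^2)(2-|A+B|(1-t^2))}{2-|A+B|(1-t^2)-2B^2t^2}$ and $\alpha$ is the unique root in $(0,1)$ of $h(t)=0$, with $h(t)=(2-|A+B|)(|A+B|+2B^2-2)-2|A+B|(2-|A+B|)t^2+|A+B|(2B^2-|A+B|)t^4$. (ii) If $(A,B)\in E_3$, then $$\|S_f\|\le \frac{2|A^2-B^2|\,(1-\sqrt{1-B^2})^2}{B^4}.$$ Moreover, every one of these estimates is sharp, i.e. for each case there is a function in $\mathcal{C}(A,B)$ attaining the bound as the value of (or supremum defining) its Schwarzian norm.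
   Context: $\mathbb{D}$ is the unit disk; $\mathcal{C}(A,B)$ for $-1\le B<A\le1$ is the set of analytic $f$ on $\mathbb{D}$ with $f(0)=0,f'(0)=1$, $f'\ne0$, and $1+\frac{zf''(z)}{f'(z)}\prec\frac{1+Az}{1+Bz}$, where $F\prec G$ means $F=G\circ\omega$ for some analytic $\omega:\mathbb{D}\to\mathbb{D}$ with $\omega(0)=0$. Schwarzian derivative $S_f=(f''/f')'-\frac12(f''/f')^2$; Schwarzian norm $\|S_f\|=\sup_{z\in\mathbb{D}}(1-|z|^2)^2|S_f(z)|$. $E=\{(A,B):-1\le B<A\le1\}$; $E_1=\{(A,B)\in E:1-\sqrt{1-B^2}<|A+B|<1+\sqrt{1-B^2}\}$, $E_2=\{(A,B)\in E:|A+B|\le 1-\sqrt{1-B^2},\ |A+B|\le|B|\}$, $E_3=\{(A,B)\in E:|A+B|\ge 1+\sqrt{1-B^2},\ |A+B|>|B|\}$. *)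

theory Defs
  imports "HOL-Complex_Analysis.Complex_Analysis"
begin

definition unit_disk :: "complex set" where
  "unit_disk = ball 0 1"

definition subordinate :: "(complex \<Rightarrow> complex) \<Rightarrow> (complex \<Rightarrow> complex) \<Rightarrow> bool" where
  "subordinate F G \<longleftrightarrow>
     (\<exists>\<omega>. \<omega> holomorphic_on unit_disk \<and> \<omega> ` unit_disk \<subseteq> unit_disk \<and> \<omega> 0 = 0 \<and>
          (\<forall>z\<in>unit_disk. F z = G (\<omega> z)))"

definition class_C :: "real \<Rightarrow> real \<Rightarrow> (complex \<Rightarrow> complex) set" where
  "class_C A B = {f. f holomorphic_on unit_disk \<and> f 0 = 0 \<and> deriv f 0 = 1 \<and>
       (\<forall>z\<in>unit_disk. deriv f z \<noteq> 0) \<and>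
       subordinate (\<lambda>z. 1 + z * deriv (deriv f) z / deriv f z)
                   (\<lambda>z. (1 + of_real A * z) / (1 + of_real B * z))}"

definition schwarzian :: "(complex \<Rightarrow> complex) \<Rightarrow> complex \<Rightarrow> complex" where
  "schwarzian f z = deriv (\<lambda>w. deriv (deriv f) w / deriv f w) z
                    - (1/2) * (deriv (deriv f) z / deriv f z)^2"

text \<open>Schwarzian norm, as an extended real (a priori it may be infinite).\<close>
definition schwarzian_norm :: "(complex \<Rightarrow> complex) \<Rightarrow> ereal" where
  "schwarzian_norm f = (SUP z\<in>unit_disk. ereal ((1 - (cmod z)^2)^2 * cmod (schwarzian f z)))"

definition E :: "(real \<times> real) set" where
  "E = {(A,B). -1 \<le> B \<and> B < A \<and> A \<le> 1}"

definition E1 :: "(real \<times> real) set" where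
  "E1 = {(A,B). (A,B) \<in> E \<and> 1 - sqrt (1 - B^2) < \<bar>A+B\<bar> \<and> \<bar>A+B\<bar> < 1 + sqrt (1 - B^2)}"

definition E2 :: "(real \<times> real) set" where
  "E2 = {(A,B). (A,B) \<in> E \<and> \<bar>A+B\<bar> \<le> 1 - sqrt (1 - B^2) \<and> \<bar>A+B\<bar> \<le> \<bar>B\<bar>}"

definition E3 :: "(real \<times> real) set" where
  "E3 = {(A,B). (A,B) \<in> E \<and> \<bar>A+B\<bar> \<ge> 1 + sqrt (1 - B^2) \<and> \<bar>A+B\<bar> > \<bar>B\<bar>}"

definition h_poly :: "real \<Rightarrow> real \<Rightarrow> real \<Rightarrow> real" where
  "h_poly A B t = (2 - \<bar>A+B\<bar>) * (\<bar>A+B\<bar> + 2*B^2 - 2) - 2*\<bar>A+B\<bar>*(2 - \<bar>A+B\<bar>)*t^2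
                  + \<bar>A+B\<bar>*(2*B^2 - \<bar>A+B\<bar>)*t^4"

definition gamma_fun :: "real \<Rightarrow> real \<Rightarrow> real \<Rightarrow> real" where
  "gamma_fun A B t = ((1 - t^2) * (2 - \<bar>A+B\<bar>*(1 - t^2))) / (2 - \<bar>A+B\<bar>*(1 - t^2) - 2*B^2*t^2)"

definition alpha_root :: "real \<Rightarrow> real \<Rightarrow> real" where
  "alpha_root A B = (THE t. 0 < t \<and> t < 1 \<and> h_poly A B t = 0)"

definition bound12 :: "real \<Rightarrow> real \<Rightarrow> real" where
  "bound12 A B =
     (if B = -1 then 2
      else if \<bar>A+B\<bar> \<le> 2*(1 - B^2) then A - B
      else (A - B) * gamma_fun A B (alpha_root A B))"

definition bound3 :: "real \<Rightarrow> real \<Rightarrow> real" where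
  "bound3 A B = 2 * \<bar>A^2 - B^2\<bar> * (1 - sqrt (1 - B^2))^2 / B^4"

end

theory Submission
  imports Defs
begin

text \<open>Writing the Schwarz function of the subordination as \<open>z \<phi>(z)\<close> with \<open>\<bar>\<phi>\<bar> \<le> 1\<close> gives
  \<open>S\<^sub>f = (A - B) (\<phi>' - (A + B) \<phi>\<^sup>2 / 2) / (1 + B z \<phi>)\<^sup>2\<close>. By Schwarz--Pick, with \<open>r = \<bar>z\<bar>\<close>,
  \<open>s = \<bar>\<phi>(z)\<bar>\<close>, \<open>c = \<bar>A + B\<bar>\<close>, \<open>b = \<bar>B\<bar>\<close> and \<open>\<kappa> = 1 - c (1 - r\<^sup>2) / 2\<close>, the weighted Schwarzian is
  at most \<open>(A - B) (1 - r\<^sup>2) (1 - \<kappa> s\<^sup>2) / (1 - b r s)\<^sup>2\<close>, and equality in Schwarz--Pick with the right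
  arguments of \<open>\<phi>\<close> and \<open>\<phi>'\<close> attains this for every \<open>r < 1\<close> and \<open>s \<le> 1\<close>. Over all real \<open>s\<close> the
  majorant is largest at \<open>s = b r / \<kappa>\<close>, with value \<open>(A - B) \<gamma>(r)\<close>; in the region \<open>E\<^sub>3\<close> that point
  reaches 1 for intermediate \<open>r\<close>, and the maximum is taken there, at \<open>s = 1\<close>. When \<open>B = -1\<close> the
  bounds are radial limits at 1 for \<open>\<phi>(z) = 1 - a + a z\<close>, where \<open>a = max A 0\<close>.\<close>

section \<open>The Schwarz--Pick lemma\<close>

lemma mem_unit_disk [simp]: "z \<in> unit_disk \<longleftrightarrow> cmod z < 1"
  by (simp add: unit_disk_def)

lemma open_unit_disk [simp]: "open unit_disk"
  by (simp add: unit_disk_def)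

lemma convex_unit_disk: "convex unit_disk"
  by (simp add: unit_disk_def)

lemma one_plus_mult_neq_0:
  fixes a b :: "'a::real_normed_div_algebra"
  assumes "norm a \<le> 1" "norm b < 1"
  shows "1 + a * b \<noteq> 0"
proof -
  have "norm (a * b) \<le> norm b"
    using assms by (simp add: norm_mult mult_left_le_one_le)
  then show ?thesis
    using assms by (metis add_eq_0_iff leD norm_minus_cancel norm_one)
qed

lemma Moebius_function_has_field_derivative:
  assumes "1 - cnj w * z \<noteq> 0"
  shows "(Moebius_function t w has_field_derivative
            exp (\<i> * of_real t) * of_real (1 - (cmod w)\<^sup>2) / (1 - cnj w * z)\<^sup>2) (at z)"
proof -
  have "((\<lambda>z. exp (\<i> * of_real t) * (z - w) / (1 - cnj w * z)) has_field_derivative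
            exp (\<i> * of_real t) * (1 - w * cnj w) / (1 - cnj w * z)\<^sup>2) (at z)"
    using assms by (auto intro!: derivative_eq_intros simp: power2_eq_square algebra_simps)
  moreover have "complex_of_real (1 - (cmod w)\<^sup>2) = 1 - w * cnj w"
    by (metis complex_norm_square of_real_1 of_real_diff)
  ultimately show ?thesis
    by (simp add: Moebius_function_def del: of_real_diff)
qed

lemma Moebius_function_has_field_derivative_at_0:
  "(Moebius_function t w has_field_derivative exp (\<i> * of_real t) * of_real (1 - (cmod w)\<^sup>2)) (at 0)"
  using Moebius_function_has_field_derivative[of w 0 t] by simp

lemma Moebius_function_has_field_derivative_at_centre:
  assumes "cmod w < 1"
  shows "(Moebius_function t w has_field_derivative
            exp (\<i> * of_real t) / of_real (1 - (cmod w)\<^sup>2)) (at w)"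
proof -
  have "(cmod w)\<^sup>2 \<noteq> 1"
    using assms by (simp add: abs_square_eq_1)
  then have nz: "complex_of_real (1 - (cmod w)\<^sup>2) \<noteq> 0"
    by (simp del: of_real_diff)
  have eq: "1 - cnj w * w = complex_of_real (1 - (cmod w)\<^sup>2)"
    by (metis complex_norm_square mult.commute of_real_1 of_real_diff)
  show ?thesis
    using Moebius_function_has_field_derivative[of w w t] nz
    unfolding eq by (simp add: power2_eq_square del: of_real_diff)
qed

definition schur_class :: "(complex \<Rightarrow> complex) set" where
  "schur_class = {\<phi>. \<phi> holomorphic_on unit_disk \<and> (\<forall>z\<in>unit_disk. cmod (\<phi> z) \<le> 1)}"

lemma schur_class_holomorphic: "\<phi> \<in> schur_class \<Longrightarrow> \<phi> holomorphic_on unit_disk"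
  and schur_class_norm_le: "\<phi> \<in> schur_class \<Longrightarrow> cmod z < 1 \<Longrightarrow> cmod (\<phi> z) \<le> 1"
  by (simp_all add: schur_class_def)

lemma schur_class_has_field_derivative:
  assumes "\<phi> \<in> schur_class" "cmod z < 1"
  shows "(\<phi> has_field_derivative deriv \<phi> z) (at z)"
  using assms by (intro holomorphic_derivI[of _ unit_disk] schur_class_holomorphic) auto

lemma schur_class_constant_or_norm_less:
  assumes "\<phi> \<in> schur_class"
  obtains "\<phi> constant_on unit_disk" | "\<And>z. cmod z < 1 \<Longrightarrow> cmod (\<phi> z) < 1"
proof (cases "\<exists>\<xi>. cmod \<xi> < 1 \<and> cmod (\<phi> \<xi>) = 1")
  case True
  then obtain \<xi> where \<xi>: "cmod \<xi> < 1" "cmod (\<phi> \<xi>) = 1"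
    by blast
  have "\<phi> constant_on unit_disk"
    by (rule maximum_modulus_principle[of _ _ unit_disk \<xi>])
      (use assms \<xi> convex_unit_disk in \<open>auto simp: schur_class_def convex_connected\<close>)
  then show ?thesis
    by (rule that(1))
next
  case False
  then show ?thesis
    using that(2) schur_class_norm_le[OF assms] by (auto simp: order_less_le)
qed

lemma Schwarz_Pick_at_zero:
  assumes hol: "\<phi> holomorphic_on ball 0 1"
    and norm_less: "\<And>z. cmod z < 1 \<Longrightarrow> cmod (\<phi> z) < 1" and z: "cmod z < 1" "\<phi> z = 0"
  shows "cmod (deriv \<phi> z) * (1 - (cmod z)\<^sup>2) \<le> 1"
proof -
  define N where "N = Moebius_function 0 (- z)"
  have N_0: "N 0 = z"
    by (simp add: N_def Moebius_function_of_zero)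
  have N_less: "cmod (N \<zeta>) < 1" if "cmod \<zeta> < 1" for \<zeta>
    unfolding N_def using z that by (intro Moebius_function_norm_lt_1) auto
  have "N holomorphic_on ball 0 1"
    unfolding N_def using z by (intro Moebius_function_holomorphic) simp
  then have "\<phi> \<circ> N holomorphic_on ball 0 1"
    using hol N_less by (intro holomorphic_on_compose_gen[where t = "ball 0 1"]) auto
  then have "cmod (deriv (\<phi> \<circ> N) 0) \<le> 1"
    using Schwarz_Lemma(2)[of "\<phi> \<circ> N" 0] z norm_less N_less by (simp add: N_0)
  moreover have "deriv (\<phi> \<circ> N) 0 = deriv \<phi> z * of_real (1 - (cmod z)\<^sup>2)"
  proof (intro DERIV_imp_deriv DERIV_chain)
    show "(N has_field_derivative of_real (1 - (cmod z)\<^sup>2)) (at 0)"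
      using Moebius_function_has_field_derivative_at_0[of 0 "- z"] by (simp add: N_def)
    show "(\<phi> has_field_derivative deriv \<phi> z) (at (N 0))"
      using hol z unfolding N_0 by (intro holomorphic_derivI[of _ "ball 0 1"]) auto
  qed
  moreover have "(cmod z)\<^sup>2 < 1"
    using z by (simp add: abs_square_less_1)
  ultimately show ?thesis
    by (simp add: norm_mult del: of_real_diff)
qed

lemma Schwarz_Pick_strict:
  assumes hol: "\<phi> holomorphic_on ball 0 1"
    and norm_less: "\<And>z. cmod z < 1 \<Longrightarrow> cmod (\<phi> z) < 1" and z: "cmod z < 1"
  shows "cmod (deriv \<phi> z) * (1 - (cmod z)\<^sup>2) \<le> 1 - (cmod (\<phi> z))\<^sup>2"
proof -
  define M where "M = Moebius_function 0 (\<phi> z)"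
  have "M holomorphic_on ball 0 1"
    unfolding M_def using z norm_less by (intro Moebius_function_holomorphic)
  then have "M \<circ> \<phi> holomorphic_on ball 0 1"
    using hol norm_less by (intro holomorphic_on_compose_gen[where t = "ball 0 1"]) auto
  moreover have "cmod ((M \<circ> \<phi>) \<zeta>) < 1" if "cmod \<zeta> < 1" for \<zeta>
    using that z by (simp add: M_def Moebius_function_norm_lt_1 norm_less)
  moreover have "(M \<circ> \<phi>) z = 0"
    by (simp add: M_def Moebius_function_eq_zero)
  ultimately have "cmod (deriv (M \<circ> \<phi>) z) * (1 - (cmod z)\<^sup>2) \<le> 1"
    using z by (intro Schwarz_Pick_at_zero)
  moreover have "deriv (M \<circ> \<phi>) z = 1 / of_real (1 - (cmod (\<phi> z))\<^sup>2) * deriv \<phi> z"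
  proof (intro DERIV_imp_deriv DERIV_chain)
    show "(\<phi> has_field_derivative deriv \<phi> z) (at z)"
      using hol z by (intro holomorphic_derivI[of _ "ball 0 1"]) auto
    show "(M has_field_derivative 1 / of_real (1 - (cmod (\<phi> z))\<^sup>2)) (at (\<phi> z))"
      using Moebius_function_has_field_derivative_at_centre[of "\<phi> z" 0] norm_less[OF z]
      by (simp add: M_def)
  qed
  moreover have "(cmod (\<phi> z))\<^sup>2 < 1"
    using z norm_less by (simp add: abs_square_less_1)
  ultimately show ?thesis
    by (simp add: norm_mult norm_divide divide_le_eq del: of_real_diff)
qed

lemma Schwarz_Pick:
  assumes \<phi>: "\<phi> \<in> schur_class" and z: "cmod z < 1"
  shows "cmod (deriv \<phi> z) * (1 - (cmod z)\<^sup>2) \<le> 1 - (cmod (\<phi> z))\<^sup>2"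
  using \<phi>
proof (cases rule: schur_class_constant_or_norm_less)
  case 1
  then obtain w where const: "\<And>\<zeta>. \<zeta> \<in> unit_disk \<Longrightarrow> \<phi> \<zeta> = w"
    by (auto simp: constant_on_def)
  have "(\<phi> has_field_derivative 0) (at z)"
    by (rule has_field_derivative_transform_within_open[of "\<lambda>_. w" 0 z unit_disk])
      (use const z in auto)
  then show ?thesis
    using schur_class_norm_le[OF \<phi> z] by (simp add: DERIV_imp_deriv abs_square_le_1)
next
  case 2
  then show ?thesis
    using \<phi> z by (intro Schwarz_Pick_strict) (auto simp: schur_class_def unit_disk_def)
qed

lemma Moebius_function_comp_schur_class:
  assumes z: "cmod z < 1" and w: "cmod w < 1"
  shows "Moebius_function u w \<circ> Moebius_function t z \<in> schur_class"
proof -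
  have "Moebius_function t z ` ball 0 1 \<subseteq> ball 0 1"
    using z by (auto intro: Moebius_function_norm_lt_1)
  then have "Moebius_function u w \<circ> Moebius_function t z holomorphic_on ball 0 1"
    using z w by (intro holomorphic_on_compose_gen[where t = "ball 0 1"] Moebius_function_holomorphic)
  moreover have "cmod (Moebius_function u w (Moebius_function t z \<zeta>)) < 1" if "cmod \<zeta> < 1" for \<zeta>
    using z w that by (intro Moebius_function_norm_lt_1)
  ultimately show ?thesis
    by (auto simp: schur_class_def unit_disk_def intro: less_imp_le)
qed

lemma Schwarz_Pick_sharp:
  assumes z: "cmod z < 1" and w: "cmod w \<le> 1" and \<eta>: "cmod \<eta> = 1"
  obtains \<phi> where "\<phi> \<in> schur_class" "\<phi> z = w"
    "deriv \<phi> z = \<eta> * of_real ((1 - (cmod w)\<^sup>2) / (1 - (cmod z)\<^sup>2))"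
proof (cases "cmod w = 1")
  case True
  then show ?thesis
    by (intro that[of "\<lambda>_. w"]) (auto simp: schur_class_def)
next
  case False
  obtain t where t: "\<eta> = exp (\<i> * of_real t)"
    using \<eta> complex_norm_eq_1_exp[of \<eta>] by metis
  define M N where "M = Moebius_function t z" and "N = Moebius_function 0 (- w)"
  have M_z: "M z = 0"
    by (simp add: M_def Moebius_function_eq_zero)
  have "N \<circ> M \<in> schur_class"
    unfolding M_def N_def using z w False by (intro Moebius_function_comp_schur_class) auto
  moreover have "(N \<circ> M) z = w"
    by (simp add: M_z N_def Moebius_function_of_zero)
  moreover have "deriv (N \<circ> M) z = of_real (1 - (cmod w)\<^sup>2) * (\<eta> / of_real (1 - (cmod z)\<^sup>2))"
  proof (intro DERIV_imp_deriv DERIV_chain)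
    show "(M has_field_derivative \<eta> / of_real (1 - (cmod z)\<^sup>2)) (at z)"
      unfolding M_def t using z by (rule Moebius_function_has_field_derivative_at_centre)
    show "(N has_field_derivative of_real (1 - (cmod w)\<^sup>2)) (at (M z))"
      using Moebius_function_has_field_derivative_at_0[of 0 "- w"] by (simp add: N_def M_z)
  qed
  ultimately show ?thesis
    by (intro that[of "N \<circ> M"]) (simp_all add: mult.commute)
qed

section \<open>Schur functions parametrise the class\<close>

definition pre_schwarzian :: "(complex \<Rightarrow> complex) \<Rightarrow> complex \<Rightarrow> complex" where
  "pre_schwarzian f = (\<lambda>z. deriv (deriv f) z / deriv f z)"

lemma schwarzian_pre_schwarzian:
  "schwarzian f z = deriv (pre_schwarzian f) z - (1/2) * (pre_schwarzian f z)\<^sup>2"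
  by (simp add: schwarzian_def pre_schwarzian_def)

definition schur_parameter :: "real \<Rightarrow> real \<Rightarrow> (complex \<Rightarrow> complex) \<Rightarrow> (complex \<Rightarrow> complex) \<Rightarrow> bool" where
  "schur_parameter A B f \<phi> \<longleftrightarrow> \<phi> \<in> schur_class \<and>
     (\<forall>z\<in>unit_disk. pre_schwarzian f z = of_real (A - B) * \<phi> z / (1 + of_real B * z * \<phi> z))"

lemma schur_denominator_neq_0:
  assumes "\<phi> \<in> schur_class" "\<bar>B\<bar> \<le> 1" "cmod z < 1"
  shows "1 + of_real B * z * \<phi> z \<noteq> 0"
proof -
  have "cmod (of_real B * \<phi> z) \<le> 1"
    using assms by (simp add: norm_mult mult_le_one schur_class_norm_le)
  then show ?thesis
    using one_plus_mult_neq_0[of "of_real B * \<phi> z" z] assms by (simp add: mult_ac)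
qed

lemma schur_pre_schwarzian_holomorphic:
  assumes "\<phi> \<in> schur_class" "\<bar>B\<bar> \<le> 1"
  shows "(\<lambda>z. of_real (A - B) * \<phi> z / (1 + of_real B * z * \<phi> z)) holomorphic_on unit_disk"
  using schur_denominator_neq_0[OF assms] schur_class_holomorphic[OF assms(1)]
  by (intro holomorphic_intros) auto

lemma Schwarz_function_factorisation:
  assumes hol: "\<omega> holomorphic_on unit_disk" and into: "\<omega> ` unit_disk \<subseteq> unit_disk" and "\<omega> 0 = 0"
  obtains \<phi> where "\<phi> \<in> schur_class" "\<And>z. cmod z < 1 \<Longrightarrow> \<omega> z = z * \<phi> z"
proof -
  obtain \<phi> where hol_\<phi>: "\<phi> holomorphic_on unit_disk"
    and \<omega>: "\<And>z. cmod z < 1 \<Longrightarrow> \<omega> z = z * \<phi> z" and \<phi>0: "deriv \<omega> 0 = \<phi> 0"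
    using Schwarz3[of \<omega> 1] hol \<open>\<omega> 0 = 0\<close> by (auto simp: unit_disk_def)
  have \<omega>_less: "cmod (\<omega> z) < 1" if "cmod z < 1" for z
    using into that by (metis image_subset_iff mem_unit_disk)
  have "cmod (\<phi> z) \<le> 1" if z: "cmod z < 1" for z
  proof (cases "z = 0")
    case True
    then show ?thesis
      using Schwarz_Lemma(2)[of \<omega> 0] hol \<open>\<omega> 0 = 0\<close> \<omega>_less \<phi>0 by (simp add: unit_disk_def)
  next
    case False
    have "cmod (z * \<phi> z) \<le> cmod z"
      using Schwarz_Lemma(1)[of \<omega> z] hol \<open>\<omega> 0 = 0\<close> \<omega>_less \<omega> z by (simp add: unit_disk_def)
    then show ?thesis
      using False by (simp add: norm_mult)
  qed
  then show ?thesis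
    using that[of \<phi>] hol_\<phi> \<omega> by (simp add: schur_class_def)
qed

lemma continuous_on_cancel_mult:
  fixes P Q :: "'a::real_normed_field \<Rightarrow> 'a"
  assumes "open S" "continuous_on S P" "continuous_on S Q"
    and eq: "\<And>z. z \<in> S \<Longrightarrow> z * P z = z * Q z" and "z \<in> S"
  shows "P z = Q z"
proof (cases "z = 0")
  case True
  then have "0 \<in> S"
    using \<open>z \<in> S\<close> by simp
  then have P: "(P \<longlongrightarrow> P 0) (at 0)" and Q: "(Q \<longlongrightarrow> Q 0) (at 0)"
    using assms(1-3) by (simp_all add: continuous_on_eq_continuous_at isCont_def)
  have "\<forall>\<^sub>F z in at 0. P z = Q z"
    using eventually_at_in_open[OF \<open>open S\<close> \<open>0 \<in> S\<close>]
  proof eventually_elim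
    case (elim z)
    then show ?case
      using eq[of z] by simp
  qed
  with P have "(Q \<longlongrightarrow> P 0) (at 0)"
    by (rule Lim_transform_eventually)
  then have "P 0 = Q 0"
    using Q by (rule tendsto_unique[OF at_neq_bot])
  then show ?thesis
    using True by simp
qed (use eq \<open>z \<in> S\<close> in auto)

lemma class_C_imp_schur_parameter:
  assumes f: "f \<in> class_C A B" and B: "\<bar>B\<bar> \<le> 1"
  obtains \<phi> where "schur_parameter A B f \<phi>"
proof -
  obtain \<omega> where \<omega>: "\<omega> holomorphic_on unit_disk" "\<omega> ` unit_disk \<subseteq> unit_disk" "\<omega> 0 = 0"
    and sub: "\<And>z. cmod z < 1 \<Longrightarrow>
      1 + z * pre_schwarzian f z = (1 + of_real A * \<omega> z) / (1 + of_real B * \<omega> z)"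
    using f by (auto simp: class_C_def subordinate_def pre_schwarzian_def)
  obtain \<phi> where \<phi>: "\<phi> \<in> schur_class" and \<omega>_eq: "\<And>z. cmod z < 1 \<Longrightarrow> \<omega> z = z * \<phi> z"
    using Schwarz_function_factorisation[OF \<omega>] by blast
  define Q where "Q z = of_real (A - B) * \<phi> z / (1 + of_real B * z * \<phi> z)" for z
  have mult_eq: "z * pre_schwarzian f z = z * Q z" if z: "z \<in> unit_disk" for z
  proof -
    have "1 + z * pre_schwarzian f z = (1 + of_real A * (z * \<phi> z)) / (1 + of_real B * z * \<phi> z)"
      using sub[of z] \<omega>_eq[of z] z by (simp add: mult_ac)
    also have "\<dots> = 1 + z * Q z"
      using schur_denominator_neq_0[OF \<phi> B, of z] z by (simp add: Q_def field_simps)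
    finally show ?thesis
      by simp
  qed
  have "pre_schwarzian f holomorphic_on unit_disk" "Q holomorphic_on unit_disk"
    unfolding pre_schwarzian_def Q_def using f schur_pre_schwarzian_holomorphic[OF \<phi> B]
    by (auto simp: class_C_def intro!: holomorphic_intros)
  then have "pre_schwarzian f z = Q z" if "z \<in> unit_disk" for z
    using continuous_on_cancel_mult[OF open_unit_disk _ _ mult_eq that]
    by (metis holomorphic_on_imp_continuous_on)
  then show ?thesis
    using that[of \<phi>] \<phi> unfolding schur_parameter_def Q_def by blast
qed

lemma holomorphic_primitive_open_convex:
  assumes "f holomorphic_on S" "open S" "convex S"
  obtains g where "g a = c" "\<And>z. z \<in> S \<Longrightarrow> (g has_field_derivative f z) (at z)"
proof -
  obtain g where "\<And>z. z \<in> S \<Longrightarrow> (g has_field_derivative f z) (at z within S)"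
    using holomorphic_convex_primitive'[OF assms(3,2,1)] by metis
  then have "(g has_field_derivative f z) (at z)" if "z \<in> S" for z
    using that at_within_open[OF that \<open>open S\<close>] by metis
  then have "((\<lambda>z. g z - g a + c) has_field_derivative f z) (at z)" if "z \<in> S" for z
    using that by (auto intro!: derivative_eq_intros)
  then show ?thesis
    by (intro that[of "\<lambda>z. g z - g a + c"]) auto
qed

lemma exists_with_pre_schwarzian:
  assumes Q: "Q holomorphic_on S" and S: "open S" "convex S" "0 \<in> S"
  obtains f where "f holomorphic_on S" "f 0 = 0" "deriv f 0 = 1"
    "\<And>z. z \<in> S \<Longrightarrow> deriv f z \<noteq> 0" "\<And>z. z \<in> S \<Longrightarrow> pre_schwarzian f z = Q z"
proof -
  obtain L where L0: "L 0 = 0" and L: "\<And>z. z \<in> S \<Longrightarrow> (L has_field_derivative Q z) (at z)"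
    using holomorphic_primitive_open_convex[OF Q S(1,2)] by metis
  have exp_L: "((\<lambda>z. exp (L z)) has_field_derivative exp (L z) * Q z) (at z)" if "z \<in> S" for z
    using L[OF that] by (auto intro!: derivative_eq_intros)
  then have "(\<lambda>z. exp (L z)) holomorphic_on S"
    using S by (auto simp: holomorphic_on_open)
  then obtain f where f0: "f 0 = 0"
    and f: "\<And>z. z \<in> S \<Longrightarrow> (f has_field_derivative exp (L z)) (at z)"
    using holomorphic_primitive_open_convex S(1,2) by metis
  have deriv_f: "deriv f z = exp (L z)" if "z \<in> S" for z
    using f[OF that] by (rule DERIV_imp_deriv)
  have "deriv (deriv f) z = exp (L z) * Q z" if "z \<in> S" for z
    by (intro DERIV_imp_deriv has_field_derivative_transform_within_open[OF exp_L[OF that] S(1) that])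
      (simp add: deriv_f)
  then have "pre_schwarzian f z = Q z" if "z \<in> S" for z
    using that by (simp add: pre_schwarzian_def deriv_f)
  moreover have "f holomorphic_on S"
    using f S by (auto simp: holomorphic_on_open)
  ultimately show ?thesis
    using that f0 S(3) by (simp add: deriv_f L0)
qed

lemma schur_parameter_surj:
  assumes \<phi>: "\<phi> \<in> schur_class" and B: "\<bar>B\<bar> \<le> 1"
  obtains f where "f \<in> class_C A B" "schur_parameter A B f \<phi>"
proof -
  obtain f where f: "f holomorphic_on unit_disk" "f 0 = 0" "deriv f 0 = 1"
      "\<And>z. z \<in> unit_disk \<Longrightarrow> deriv f z \<noteq> 0"
    and eq: "\<And>z. z \<in> unit_disk \<Longrightarrow>
      pre_schwarzian f z = of_real (A - B) * \<phi> z / (1 + of_real B * z * \<phi> z)"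
    by (rule exists_with_pre_schwarzian[OF schur_pre_schwarzian_holomorphic[OF \<phi> B, of A]])
      (auto simp: convex_unit_disk)
  have "subordinate (\<lambda>z. 1 + z * deriv (deriv f) z / deriv f z)
                   (\<lambda>z. (1 + of_real A * z) / (1 + of_real B * z))"
    unfolding subordinate_def
  proof (intro exI[of _ "\<lambda>z. z * \<phi> z"] conjI ballI)
    show "(\<lambda>z. z * \<phi> z) holomorphic_on unit_disk"
      using \<phi> by (intro holomorphic_intros schur_class_holomorphic)
    have "cmod (z * \<phi> z) < 1" if "cmod z < 1" for z
      using mult_left_le[of "cmod (\<phi> z)" "cmod z"] schur_class_norm_le[OF \<phi> that] that
      by (simp add: norm_mult)
    then show "(\<lambda>z. z * \<phi> z) ` unit_disk \<subseteq> unit_disk"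
      by auto
    fix z :: complex assume z: "z \<in> unit_disk"
    have "1 + z * deriv (deriv f) z / deriv f z = 1 + z * pre_schwarzian f z"
      by (simp add: pre_schwarzian_def)
    also have "\<dots> = (1 + of_real A * (z * \<phi> z)) / (1 + of_real B * (z * \<phi> z))"
      using schur_denominator_neq_0[OF \<phi> B, of z] z by (simp add: eq[OF z] field_simps)
    finally show "1 + z * deriv (deriv f) z / deriv f z = \<dots>" .
  qed simp
  then have "f \<in> class_C A B"
    using f by (simp add: class_C_def)
  then show ?thesis
    using that \<phi> eq by (simp add: schur_parameter_def)
qed

lemma schwarzian_schur_parameter:
  assumes f: "schur_parameter A B f \<phi>" and B: "\<bar>B\<bar> \<le> 1" and z: "cmod z < 1"
  shows "schwarzian f z = of_real (A - B) * (deriv \<phi> z - of_real ((A + B) / 2) * (\<phi> z)\<^sup>2)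
           / (1 + of_real B * z * \<phi> z)\<^sup>2"
proof -
  define a b K where "a = complex_of_real (A - B)" and "b = complex_of_real B"
    and "K = 1 + b * z * \<phi> z"
  have \<phi>: "\<phi> \<in> schur_class"
    and eq: "\<And>z. z \<in> unit_disk \<Longrightarrow> pre_schwarzian f z = a * \<phi> z / (1 + b * z * \<phi> z)"
    using f by (simp_all add: schur_parameter_def a_def b_def)
  have K: "K \<noteq> 0"
    using schur_denominator_neq_0[OF \<phi> B z] by (simp add: K_def b_def)
  have "((\<lambda>z. a * \<phi> z / (1 + b * z * \<phi> z)) has_field_derivative
      a * (deriv \<phi> z - b * (\<phi> z)\<^sup>2) / K\<^sup>2) (at z)"
    unfolding K_def
    by (rule derivative_eq_intros schur_class_has_field_derivative[OF \<phi> z] refl K[unfolded K_def])+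
      (simp add: power2_eq_square algebra_simps)
  then have "(pre_schwarzian f has_field_derivative a * (deriv \<phi> z - b * (\<phi> z)\<^sup>2) / K\<^sup>2) (at z)"
    by (rule has_field_derivative_transform_within_open[of _ _ _ unit_disk]) (use eq z in auto)
  then have "schwarzian f z = a * (deriv \<phi> z - b * (\<phi> z)\<^sup>2) / K\<^sup>2 - (1/2) * (a * \<phi> z / K)\<^sup>2"
    using eq[of z] z by (simp add: schwarzian_pre_schwarzian DERIV_imp_deriv K_def)
  also have "\<dots> = a * (deriv \<phi> z - (b + a / 2) * (\<phi> z)\<^sup>2) / K\<^sup>2"
    using K by (simp add: field_simps power2_eq_square)
  also have "b + a / 2 = of_real ((A + B) / 2)"
    by (simp add: a_def b_def field_simps)
  finally show ?thesis
    by (simp add: a_def b_def K_def)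
qed

section \<open>The two-variable majorant\<close>

definition weighted_schwarzian :: "(complex \<Rightarrow> complex) \<Rightarrow> complex \<Rightarrow> real" where
  "weighted_schwarzian f z = (1 - (cmod z)\<^sup>2)\<^sup>2 * cmod (schwarzian f z)"

lemma schwarzian_norm_leI:
  assumes "\<And>z. cmod z < 1 \<Longrightarrow> weighted_schwarzian f z \<le> M"
  shows "schwarzian_norm f \<le> ereal M"
  unfolding schwarzian_norm_def
  using assms by (intro SUP_least) (simp add: weighted_schwarzian_def)

lemma weighted_schwarzian_le_norm:
  assumes "cmod z < 1"
  shows "ereal (weighted_schwarzian f z) \<le> schwarzian_norm f"
  unfolding schwarzian_norm_def weighted_schwarzian_def
  using assms by (intro SUP_upper) simp

lemma tendsto_weighted_schwarzian_le_norm: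
  assumes "((\<lambda>x. weighted_schwarzian f (g x)) \<longlongrightarrow> M) F" "F \<noteq> bot" "\<forall>\<^sub>F x in F. cmod (g x) < 1"
  shows "ereal M \<le> schwarzian_norm f"
proof (rule tendsto_upperbound)
  show "((\<lambda>x. ereal (weighted_schwarzian f (g x))) \<longlongrightarrow> ereal M) F"
    using assms(1) by (rule tendsto_ereal)
  show "\<forall>\<^sub>F x in F. ereal (weighted_schwarzian f (g x)) \<le> schwarzian_norm f"
    using assms(3) by (rule eventually_mono) (rule weighted_schwarzian_le_norm)
qed fact

lemma weighted_schwarzian_of_real:
  assumes f: "schur_parameter A B f \<phi>" and B: "\<bar>B\<bar> \<le> 1" and x: "\<bar>x\<bar> < 1"
    and y: "\<phi> (of_real x) = of_real y" and d: "deriv \<phi> (of_real x) = of_real d"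
  shows "weighted_schwarzian f (of_real x)
           = \<bar>A - B\<bar> * ((1 - x\<^sup>2)\<^sup>2 * \<bar>d - (A + B) / 2 * y\<^sup>2\<bar> / (1 + B * x * y)\<^sup>2)"
proof -
  have "schwarzian f (of_real x)
      = of_real ((A - B) * (d - (A + B) / 2 * y\<^sup>2) / (1 + B * x * y)\<^sup>2)"
    using schwarzian_schur_parameter[OF f B, of "of_real x"] x by (simp add: y d)
  then have "cmod (schwarzian f (of_real x))
      = \<bar>A - B\<bar> * \<bar>d - (A + B) / 2 * y\<^sup>2\<bar> / (1 + B * x * y)\<^sup>2"
    by (simp only: norm_of_real abs_mult abs_divide) simp
  then show ?thesis
    by (simp add: weighted_schwarzian_def)
qed

definition kappa :: "real \<Rightarrow> real \<Rightarrow> real" where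
  "kappa c r = 1 - c / 2 * (1 - r\<^sup>2)"

definition pick_majorant :: "real \<Rightarrow> real \<Rightarrow> real \<Rightarrow> real \<Rightarrow> real" where
  "pick_majorant c b r s = (1 - r\<^sup>2) * (1 - kappa c r * s\<^sup>2) / (1 - b * r * s)\<^sup>2"

lemma pick_denominator_pos:
  fixes b r s :: real
  assumes "0 \<le> b" "b \<le> 1" "0 \<le> r" "r < 1" "0 \<le> s" "s \<le> 1"
  shows "0 < 1 - b * r * s"
proof -
  have "b * s * r \<le> r"
    using assms by (simp add: mult_left_le_one_le mult_le_one)
  then show ?thesis
    using assms by (simp add: mult_ac)
qed

lemma weighted_schwarzian_le_pick_majorant:
  assumes f: "schur_parameter A B f \<phi>" and B: "\<bar>B\<bar> \<le> 1" and z: "cmod z < 1"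
  shows "weighted_schwarzian f z
           \<le> \<bar>A - B\<bar> * pick_majorant \<bar>A + B\<bar> \<bar>B\<bar> (cmod z) (cmod (\<phi> z))"
proof -
  define r s u where "r = cmod z" and "s = cmod (\<phi> z)" and "u = 1 - r\<^sup>2"
  define T where "T = deriv \<phi> z - of_real ((A + B) / 2) * (\<phi> z)\<^sup>2"
  define K where "K = 1 + of_real B * z * \<phi> z"
  have \<phi>: "\<phi> \<in> schur_class"
    using f by (simp add: schur_parameter_def)
  have u: "0 < u"
    using z by (simp add: u_def r_def abs_square_less_1)
  have "cmod (of_real ((A + B) / 2) * (\<phi> z)\<^sup>2) = \<bar>A + B\<bar> / 2 * s\<^sup>2"
    by (simp only: norm_mult norm_of_real norm_power s_def abs_divide abs_numeral)
  then have "cmod T \<le> cmod (deriv \<phi> z) + \<bar>A + B\<bar> / 2 * s\<^sup>2"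
    unfolding T_def by (metis norm_triangle_ineq4)
  then have "u * cmod T \<le> u * (cmod (deriv \<phi> z) + \<bar>A + B\<bar> / 2 * s\<^sup>2)"
    using u by (intro mult_left_mono) auto
  also have "\<dots> \<le> 1 - kappa \<bar>A + B\<bar> r * s\<^sup>2"
    using Schwarz_Pick[OF \<phi> z] by (simp add: kappa_def r_def s_def u_def algebra_simps)
  finally have num: "u * cmod T \<le> 1 - kappa \<bar>A + B\<bar> r * s\<^sup>2" .
  have pos: "0 < 1 - \<bar>B\<bar> * r * s"
    using B z schur_class_norm_le[OF \<phi> z] by (intro pick_denominator_pos) (auto simp: r_def s_def)
  have den: "1 - \<bar>B\<bar> * r * s \<le> cmod K"
    using norm_diff_ineq[of 1 "of_real B * z * \<phi> z"] by (simp add: norm_mult K_def r_def s_def)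
  have "weighted_schwarzian f z = \<bar>A - B\<bar> * (u * (u * cmod T) / (cmod K)\<^sup>2)"
    unfolding weighted_schwarzian_def schwarzian_schur_parameter[OF f B z] T_def[symmetric] K_def[symmetric]
    by (simp only: norm_mult norm_divide norm_power norm_of_real)
      (simp add: u_def r_def power2_eq_square)
  also have "\<dots> \<le> \<bar>A - B\<bar> * (u * (1 - kappa \<bar>A + B\<bar> r * s\<^sup>2) / (1 - \<bar>B\<bar> * r * s)\<^sup>2)"
    using u num den pos
    by (intro mult_left_mono frac_le power_mono mult_nonneg_nonneg order_trans[OF _ num]) auto
  finally show ?thesis
    by (simp add: pick_majorant_def r_def s_def u_def)
qed

lemma schwarzian_norm_le_of_pick_majorant:
  assumes f: "f \<in> class_C A B" and B: "\<bar>B\<bar> \<le> 1"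
    and M: "\<And>r s. 0 \<le> r \<Longrightarrow> r < 1 \<Longrightarrow> 0 \<le> s \<Longrightarrow> s \<le> 1 \<Longrightarrow>
              \<bar>A - B\<bar> * pick_majorant \<bar>A + B\<bar> \<bar>B\<bar> r s \<le> M"
  shows "schwarzian_norm f \<le> ereal M"
proof (rule schwarzian_norm_leI)
  fix z :: complex assume z: "cmod z < 1"
  obtain \<phi> where \<phi>: "schur_parameter A B f \<phi>"
    using class_C_imp_schur_parameter[OF f B] by blast
  then have "cmod (\<phi> z) \<le> 1"
    using z by (simp add: schur_parameter_def schur_class_norm_le)
  then show "weighted_schwarzian f z \<le> M"
    using weighted_schwarzian_le_pick_majorant[OF \<phi> B z] M[of "cmod z" "cmod (\<phi> z)"] z by simp
qed

lemma weighted_schwarzian_at_Schwarz_Pick_equality: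
  assumes B: "\<bar>B\<bar> \<le> 1" and x: "\<bar>x\<bar> < 1" and y: "\<bar>y\<bar> \<le> 1" and \<eta>: "\<bar>\<eta>\<bar> = 1"
  shows "\<exists>f\<in>class_C A B. weighted_schwarzian f (of_real x)
           = \<bar>A - B\<bar> * ((1 - x\<^sup>2)\<^sup>2 * \<bar>\<eta> * ((1 - y\<^sup>2) / (1 - x\<^sup>2)) - (A + B) / 2 * y\<^sup>2\<bar> / (1 + B * x * y)\<^sup>2)"
proof -
  obtain \<phi> where \<phi>: "\<phi> \<in> schur_class" "\<phi> (of_real x) = of_real y"
      "deriv \<phi> (of_real x) = of_real (\<eta> * ((1 - y\<^sup>2) / (1 - x\<^sup>2)))"
    using Schwarz_Pick_sharp[of "of_real x" "of_real y" "of_real \<eta>"] x y \<eta> by auto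
  obtain f where "f \<in> class_C A B" "schur_parameter A B f \<phi>"
    using schur_parameter_surj[OF \<phi>(1) B] by blast
  then show ?thesis
    using weighted_schwarzian_of_real[OF _ B x \<phi>(2,3)] by blast
qed

lemma pick_majorant_attained:
  assumes B: "\<bar>B\<bar> \<le> 1" and r: "0 \<le> r" "r < 1" and s: "0 \<le> s" "s \<le> 1"
  shows "\<exists>f\<in>class_C A B.
           weighted_schwarzian f (of_real r) = \<bar>A - B\<bar> * pick_majorant \<bar>A + B\<bar> \<bar>B\<bar> r s"
proof -
  define c where "c = \<bar>A + B\<bar>"
  have sign: "\<exists>e. \<bar>e\<bar> = 1 \<and> x = - e * \<bar>x\<bar>" for x :: real
    by (rule exI[of _ "if x < 0 then 1 else -1"]) auto
  obtain \<epsilon> where \<epsilon>: "\<bar>\<epsilon>\<bar> = 1" "B = - \<epsilon> * \<bar>B\<bar>"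
    using sign by blast
  obtain \<eta> where \<eta>: "\<bar>\<eta>\<bar> = 1" "A + B = - \<eta> * c"
    using sign unfolding c_def by blast
  have square: "(\<epsilon> * s)\<^sup>2 = s\<^sup>2"
    using \<epsilon>(1) by (metis mult_1 one_power2 power2_abs power_mult_distrib)
  have pos: "0 < 1 - r\<^sup>2" "0 \<le> 1 - s\<^sup>2"
    using r s by (simp_all add: abs_square_less_1 abs_square_le_1)
  have num: "\<eta> * ((1 - s\<^sup>2) / (1 - r\<^sup>2)) - (A + B) / 2 * s\<^sup>2 = \<eta> * ((1 - kappa c r * s\<^sup>2) / (1 - r\<^sup>2))"
    unfolding \<eta>(2) using pos by (simp add: kappa_def field_simps)
  have "kappa c r * s\<^sup>2 \<le> 1 * s\<^sup>2"
    using pos by (intro mult_right_mono) (auto simp: kappa_def c_def)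
  then have "\<bar>\<eta> * ((1 - s\<^sup>2) / (1 - r\<^sup>2)) - (A + B) / 2 * s\<^sup>2\<bar> = (1 - kappa c r * s\<^sup>2) / (1 - r\<^sup>2)"
    unfolding num using \<eta>(1) pos by (simp add: abs_mult)
  moreover have "B * r * (\<epsilon> * s) = - \<bar>B\<bar> * r * s"
    using \<epsilon> by (metis abs_mult_self_eq mult.assoc mult.commute mult.left_commute mult_1 mult_minus_left)
  moreover have "(1 - r\<^sup>2)\<^sup>2 * ((1 - kappa c r * s\<^sup>2) / (1 - r\<^sup>2)) = (1 - r\<^sup>2) * (1 - kappa c r * s\<^sup>2)"
    using pos by (simp add: power2_eq_square)
  ultimately show ?thesis
    using weighted_schwarzian_at_Schwarz_Pick_equality[OF B _ _ \<eta>(1), of r "\<epsilon> * s" A] r s \<epsilon>(1)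
    by (simp add: square pick_majorant_def abs_mult c_def)
qed

lemma pick_majorant_le_schwarzian_norm:
  assumes "\<bar>B\<bar> \<le> 1" "0 \<le> r" "r < 1" "0 \<le> s" "s \<le> 1"
  shows "\<exists>f\<in>class_C A B.
           ereal (\<bar>A - B\<bar> * pick_majorant \<bar>A + B\<bar> \<bar>B\<bar> r s) \<le> schwarzian_norm f"
  using pick_majorant_attained[OF assms, of A] weighted_schwarzian_le_norm[of "of_real r"] assms
  by (metis abs_of_nonneg norm_of_real)

lemma affine_schur_class:
  assumes "0 \<le> a" "a \<le> 1"
  shows "(\<lambda>z. of_real (1 - a) + of_real a * z) \<in> schur_class"
proof -
  have "cmod (of_real (1 - a) + of_real a * z) \<le> 1" if "cmod z < 1" for z
  proof -
    have "cmod (of_real (1 - a) + of_real a * z) \<le> cmod (of_real (1 - a)) + cmod (of_real a * z)"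
      by (rule norm_triangle_ineq)
    also have "\<dots> = 1 - a + a * cmod z"
      using assms by (simp add: norm_mult del: of_real_diff)
    also have "\<dots> \<le> 1"
      using assms that by (simp add: mult_left_le)
    finally show ?thesis .
  qed
  then show ?thesis
    by (auto simp: schur_class_def intro!: holomorphic_intros)
qed

lemma weighted_schwarzian_affine_schur_parameter:
  assumes f: "schur_parameter A (-1) f (\<lambda>z. of_real (1 - a) + of_real a * z)" and x: "\<bar>x\<bar> < 1"
  shows "weighted_schwarzian f (of_real x)
           = \<bar>A + 1\<bar> * ((1 + x)\<^sup>2 * \<bar>a - (A - 1) / 2 * (1 - a + a * x)\<^sup>2\<bar> / (1 + a * x)\<^sup>2)"
proof -
  have "((\<lambda>z. of_real (1 - a) + of_real a * z) has_field_derivative of_real a) (at z)" for z :: complex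
    by (auto intro!: derivative_eq_intros)
  then have "weighted_schwarzian f (of_real x) = \<bar>A - - 1\<bar> *
      ((1 - x\<^sup>2)\<^sup>2 * \<bar>a - (A + - 1) / 2 * (1 - a + a * x)\<^sup>2\<bar> / (1 + - 1 * x * (1 - a + a * x))\<^sup>2)"
    using x by (intro weighted_schwarzian_of_real[OF f]) (auto intro: DERIV_imp_deriv)
  moreover have "1 + - 1 * x * (1 - a + a * x) = (1 - x) * (1 + a * x)" "1 - x\<^sup>2 = (1 - x) * (1 + x)"
    by (simp_all add: algebra_simps power2_eq_square)
  moreover have "1 - x \<noteq> 0"
    using x by simp
  ultimately show ?thesis
    by (simp add: power_mult_distrib del: right_minus_eq)
qed

text \<open>When \<open>B = -1\<close> the majorant need not attain its supremum; the norm is then bounded below by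
  the radial limit at the boundary point 1, where \<open>\<phi>\<close> has the value 1 and the derivative \<open>a\<close>.\<close>

lemma schwarzian_norm_ge_affine_schur_parameter:
  assumes A: "-1 \<le> A" "A \<le> 1" and a: "0 \<le> a" "a \<le> 1"
  shows "\<exists>f\<in>class_C A (-1). ereal (2 * (1 + A) * (1 - A + 2 * a) / (1 + a)\<^sup>2) \<le> schwarzian_norm f"
proof -
  obtain f where f: "f \<in> class_C A (-1)"
      "schur_parameter A (-1) f (\<lambda>z. of_real (1 - a) + of_real a * z)"
    using schur_parameter_surj[OF affine_schur_class[OF a], of "-1"] by auto
  define p where "p x = \<bar>A + 1\<bar> *
      ((1 + x)\<^sup>2 * \<bar>a - (A - 1) / 2 * (1 - a + a * x)\<^sup>2\<bar> / (1 + a * x)\<^sup>2)" for x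
  have inside: "\<forall>\<^sub>F x in at_left 1. \<bar>x\<bar> < (1::real)"
    using eventually_at_left_real[of 0 1] by (auto elim!: eventually_mono)
  then have "\<forall>\<^sub>F x in at_left 1. p x = weighted_schwarzian f (of_real x)"
    by (rule eventually_mono) (simp add: weighted_schwarzian_affine_schur_parameter[OF f(2)] p_def)
  moreover have "(p \<longlongrightarrow> p 1) (at_left 1)"
    unfolding p_def using a by (intro tendsto_intros) auto
  ultimately have "((\<lambda>x. weighted_schwarzian f (of_real x)) \<longlongrightarrow> p 1) (at_left 1)"
    by (rule Lim_transform_eventually[rotated])
  then have "ereal (p 1) \<le> schwarzian_norm f"
    using inside by (intro tendsto_weighted_schwarzian_le_norm) auto
  moreover have "p 1 = 2 * (1 + A) * (1 - A + 2 * a) / (1 + a)\<^sup>2"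
    using A a by (simp add: p_def abs_of_nonneg field_simps)
  ultimately show ?thesis
    using f(1) by auto
qed

section \<open>Maximising the majorant\<close>

lemma kappa_le_1: "0 \<le> c \<Longrightarrow> \<bar>r\<bar> \<le> 1 \<Longrightarrow> kappa c r \<le> 1"
  by (simp add: kappa_def abs_square_le_1)

lemma square_mult_less_kappa:
  assumes "c < 2" "\<bar>b\<bar> \<le> 1" "\<bar>r\<bar> < 1"
  shows "b\<^sup>2 * r\<^sup>2 < kappa c r"
proof -
  have "0 < (1 - c / 2) * (1 - r\<^sup>2)" "0 \<le> (1 - b\<^sup>2) * r\<^sup>2"
    using assms by (simp_all add: abs_square_less_1 abs_square_le_1)
  then show ?thesis
    by (simp add: kappa_def algebra_simps)
qed

lemma gamma_fun_eq_kappa: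
  "gamma_fun A B r
     = (1 - r\<^sup>2) * kappa \<bar>A + B\<bar> r / (kappa \<bar>A + B\<bar> r - B\<^sup>2 * r\<^sup>2)"
proof -
  have "2 - \<bar>A + B\<bar> * (1 - r\<^sup>2) = 2 * kappa \<bar>A + B\<bar> r"
    by (simp add: kappa_def field_simps)
  then have "gamma_fun A B r
      = 2 * ((1 - r\<^sup>2) * kappa \<bar>A + B\<bar> r) / (2 * (kappa \<bar>A + B\<bar> r - B\<^sup>2 * r\<^sup>2))"
    by (simp add: gamma_fun_def algebra_simps)
  then show ?thesis
    by (simp only: mult_divide_mult_cancel_left_if) simp
qed

lemma gamma_fun_minus_1:
  assumes "-1 < A" "A \<le> 1" "\<bar>r\<bar> < 1"
  shows "(A + 1) * gamma_fun A (-1) r = 2 * kappa (1 - A) r"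
proof -
  define k d where "k = kappa (1 - A) r" and "d = k - r\<^sup>2"
  have "d \<noteq> 0"
    using square_mult_less_kappa[of "1 - A" 1 r] assms by (simp add: d_def k_def)
  have "(A + 1) * gamma_fun A (-1) r = (A + 1) * (1 - r\<^sup>2) * k / d"
    using assms by (simp add: gamma_fun_eq_kappa d_def k_def)
  also have "(A + 1) * (1 - r\<^sup>2) = 2 * d"
    by (simp add: d_def k_def kappa_def field_simps)
  finally show ?thesis
    using \<open>d \<noteq> 0\<close> by (simp add: k_def)
qed

lemma pick_majorant_le_gamma_fun:
  assumes c: "\<bar>A + B\<bar> < 2" and B: "\<bar>B\<bar> \<le> 1" and r: "0 \<le> r" "r < 1" and s: "0 \<le> s" "s \<le> 1"
  shows "pick_majorant \<bar>A + B\<bar> \<bar>B\<bar> r s \<le> gamma_fun A B r"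
proof -
  define k where "k = kappa \<bar>A + B\<bar> r"
  have k: "0 < k - B\<^sup>2 * r\<^sup>2"
    using square_mult_less_kappa[of "\<bar>A + B\<bar>" B r] c B r by (simp add: k_def)
  have pos: "0 < 1 - \<bar>B\<bar> * r * s"
    using B r s by (intro pick_denominator_pos) auto
  have "k * (1 - \<bar>B\<bar> * r * s)\<^sup>2 - (1 - k * s\<^sup>2) * (k - \<bar>B\<bar>\<^sup>2 * r\<^sup>2) = (\<bar>B\<bar> * r - k * s)\<^sup>2"
    by algebra
  then have "(1 - k * s\<^sup>2) * (k - B\<^sup>2 * r\<^sup>2) \<le> k * (1 - \<bar>B\<bar> * r * s)\<^sup>2"
    by (metis diff_ge_0_iff_ge power2_abs zero_le_power2)
  then have "(1 - k * s\<^sup>2) / (1 - \<bar>B\<bar> * r * s)\<^sup>2 \<le> k / (k - B\<^sup>2 * r\<^sup>2)"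
    using k pos by (simp add: divide_le_eq le_divide_eq)
  then have "(1 - r\<^sup>2) * ((1 - k * s\<^sup>2) / (1 - \<bar>B\<bar> * r * s)\<^sup>2) \<le> (1 - r\<^sup>2) * (k / (k - B\<^sup>2 * r\<^sup>2))"
    using r by (intro mult_left_mono) (simp_all add: abs_square_le_1)
  then show ?thesis
    by (simp add: pick_majorant_def gamma_fun_eq_kappa k_def)
qed

lemma pick_majorant_eq_gamma_fun:
  assumes "B\<^sup>2 * r\<^sup>2 < kappa \<bar>A + B\<bar> r"
  shows "pick_majorant \<bar>A + B\<bar> \<bar>B\<bar> r (\<bar>B\<bar> * r / kappa \<bar>A + B\<bar> r) = gamma_fun A B r"
proof -
  define k d where "k = kappa \<bar>A + B\<bar> r" and "d = k - B\<^sup>2 * r\<^sup>2"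
  have d: "0 < d"
    using assms by (simp add: k_def d_def)
  moreover have "0 \<le> B\<^sup>2 * r\<^sup>2"
    by simp
  ultimately have k: "0 < k"
    unfolding d_def by linarith
  have "1 - k * (\<bar>B\<bar> * r / k)\<^sup>2 = d / k" "1 - \<bar>B\<bar> * r * (\<bar>B\<bar> * r / k) = d / k"
    using k by (simp_all add: d_def field_simps power2_eq_square)
  then have "pick_majorant \<bar>A + B\<bar> \<bar>B\<bar> r (\<bar>B\<bar> * r / k) = (1 - r\<^sup>2) * (d / k) / (d / k)\<^sup>2"
    by (simp only: pick_majorant_def flip: k_def)
  also have "\<dots> = (1 - r\<^sup>2) * k / d"
    using k d by (simp add: power2_eq_square)
  finally show ?thesis
    by (simp add: gamma_fun_eq_kappa d_def k_def)
qed

lemma gamma_fun_le_1: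
  assumes c: "\<bar>A + B\<bar> < 2" and B: "\<bar>B\<bar> \<le> 1" and r: "\<bar>r\<bar> < 1"
    and small: "\<bar>A + B\<bar> \<le> 2 * (1 - B\<^sup>2)"
  shows "gamma_fun A B r \<le> 1"
proof -
  define k where "k = kappa \<bar>A + B\<bar> r"
  have "\<bar>A + B\<bar> * (1 - r\<^sup>2) \<le> \<bar>A + B\<bar>"
    by (simp add: mult_left_le)
  then have "B\<^sup>2 \<le> k"
    using small unfolding k_def kappa_def by argo
  then have "B\<^sup>2 * r\<^sup>2 \<le> k * r\<^sup>2"
    by (rule mult_right_mono) simp
  then have "(1 - r\<^sup>2) * k \<le> k - B\<^sup>2 * r\<^sup>2"
    by (simp add: algebra_simps)
  then show ?thesis
    using square_mult_less_kappa[OF c B r] by (simp add: gamma_fun_eq_kappa k_def)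
qed

text \<open>With \<open>x = r\<^sup>2\<close>, \<open>\<gamma> = N / D\<close> for a quadratic \<open>N\<close> with leading coefficient
  \<open>- \<bar>A + B\<bar> / 2\<close> and a linear \<open>D\<close>, and \<open>h = 4 (N' D - N D')\<close>; hence at a zero \<open>y\<close> of \<open>h\<close>
  the quadratic \<open>N - \<gamma>(y) D\<close> has a double zero.\<close>

lemma gamma_fun_le_critical:
  assumes c: "\<bar>A + B\<bar> < 2" and B: "\<bar>B\<bar> \<le> 1" and r: "\<bar>r\<bar> < 1" and t: "\<bar>t\<bar> < 1"
    and h: "h_poly A B t = 0"
  shows "gamma_fun A B r \<le> gamma_fun A B t"
proof -
  define c where "c = \<bar>A + B\<bar>"
  define N D where "N u = (1 - u\<^sup>2) * kappa c u" and "D u = kappa c u - B\<^sup>2 * u\<^sup>2" for u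
  have D: "0 < D r" "0 < D t"
    using square_mult_less_kappa[of c B] c B r t by (simp_all add: D_def c_def)
  have "(2 - c) * (c + 2 * B\<^sup>2 - 2) - 2 * c * (2 - c) * t\<^sup>2 + c * (2 * B\<^sup>2 - c) * t ^ 4 = 0"
    using h by (simp add: h_poly_def c_def)
  then have "2 * (N r * D t - N t * D r) = - c * (r\<^sup>2 - t\<^sup>2)\<^sup>2 * D t"
    unfolding N_def D_def kappa_def by (simp add: field_simps) algebra
  also have "\<dots> \<le> 0"
    using D by (simp add: c_def mult_nonneg_nonneg)
  finally have "N r / D r \<le> N t / D t"
    using D by (simp add: divide_le_eq le_divide_eq field_simps)
  then show ?thesis
    by (simp add: gamma_fun_eq_kappa N_def D_def c_def)
qed

lemma h_poly_strict_decreasing: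
  assumes c: "0 < \<bar>A + B\<bar>" "\<bar>A + B\<bar> < 2" and B: "\<bar>B\<bar> \<le> 1" and uv: "0 \<le> u" "u < v" "v < 1"
  shows "h_poly A B v < h_poly A B u"
proof -
  define c where "c = \<bar>A + B\<bar>"
  have "u\<^sup>2 < v\<^sup>2"
    using uv by (simp add: power_strict_mono)
  moreover have "B\<^sup>2 * u\<^sup>2 < kappa c u" "B\<^sup>2 * v\<^sup>2 < kappa c v"
    using square_mult_less_kappa[of c B] c B uv by (simp_all add: c_def)
  ultimately have "0 < 2 * c * (v\<^sup>2 - u\<^sup>2) * ((kappa c u - B\<^sup>2 * u\<^sup>2) + (kappa c v - B\<^sup>2 * v\<^sup>2))"
    using c by (intro mult_pos_pos add_pos_pos) (auto simp: c_def)
  also have "\<dots> = h_poly A B u - h_poly A B v"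
    unfolding h_poly_def kappa_def c_def[symmetric] by (simp add: field_simps)
  finally show ?thesis
    by simp
qed

lemma h_poly_unique_root:
  assumes B: "\<bar>B\<bar> < 1" and c: "\<bar>A + B\<bar> < 2" and large: "2 * (1 - B\<^sup>2) < \<bar>A + B\<bar>"
  shows "\<exists>!t. 0 < t \<and> t < 1 \<and> h_poly A B t = 0"
proof -
  have B_square_less: "B\<^sup>2 < 1"
    using B by (simp add: abs_square_less_1)
  then have "0 < 2 * (1 - B\<^sup>2)"
    by simp
  then have c_pos: "0 < \<bar>A + B\<bar>"
    using large by (rule less_trans)
  have "h_poly A B 1 = - 4 * (1 - B\<^sup>2)"
    by (simp add: h_poly_def algebra_simps)
  then have h_at_1_neg: "h_poly A B 1 < 0"
    using B_square_less by simp
  have h_at_0_pos: "0 < h_poly A B 0"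
    using large c by (simp add: h_poly_def)
  have "continuous_on {0..1} (h_poly A B)"
    unfolding h_poly_def by (intro continuous_intros)
  then obtain t where "0 \<le> t" "t \<le> 1" "h_poly A B t = 0"
    using IVT2'[of "h_poly A B" 1 0 0] h_at_0_pos h_at_1_neg by auto
  then have "0 < t \<and> t < 1 \<and> h_poly A B t = 0"
    using h_at_0_pos h_at_1_neg by (auto simp: order_less_le)
  moreover have "t' = t" if "0 < t' \<and> t' < 1 \<and> h_poly A B t' = 0" for t'
    using h_poly_strict_decreasing[OF c_pos c, of t t'] h_poly_strict_decreasing[OF c_pos c, of t' t]
      calculation that B by (cases t t' rule: linorder_cases) auto
  ultimately show ?thesis
    by blast
qed

lemma alpha_root_is_root:
  assumes "\<bar>B\<bar> < 1" "\<bar>A + B\<bar> < 2" "2 * (1 - B\<^sup>2) < \<bar>A + B\<bar>"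
  shows "0 < alpha_root A B" "alpha_root A B < 1" "h_poly A B (alpha_root A B) = 0"
  using theI'[OF h_poly_unique_root[OF assms]] by (auto simp: alpha_root_def)

lemma mult_less_kappa_of_discriminant:
  fixes b c t :: real
  assumes "b\<^sup>2 < c * (2 - c)"
  shows "b * t < kappa c t"
proof -
  have c: "0 < c"
  proof (rule ccontr)
    assume "\<not> 0 < c"
    then have "c * (2 - c) \<le> 0"
      by (intro mult_nonpos_nonneg) auto
    then show False
      using assms zero_le_power2[of b] by linarith
  qed
  have "0 < (c * t - b)\<^sup>2 + (c * (2 - c) - b\<^sup>2)"
    using assms by (intro add_nonneg_pos) auto
  also have "\<dots> = 2 * c * (kappa c t - b * t)"
    by (simp add: kappa_def power2_eq_square field_simps)
  finally show ?thesis
    using c by (simp add: zero_less_mult_iff)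
qed

lemma mult_less_kappa_of_le:
  fixes b c t :: real
  assumes "0 \<le> c" "c \<le> b" "b < 1" "0 \<le> t" "t \<le> 1"
  shows "b * t < kappa c t"
proof -
  have "c * (1 + t) \<le> b * 2"
    using assms by (intro mult_mono) auto
  then have "0 \<le> (1 - t) * (2 * b - c * (1 + t))"
    using assms by simp
  then have "0 < 2 * (1 - b) + (1 - t) * (2 * b - c * (1 + t))"
    using assms by (intro add_pos_nonneg) auto
  also have "\<dots> = 2 * (kappa c t - b * t)"
    by (simp add: kappa_def power2_eq_square field_simps)
  finally show ?thesis
    by simp
qed

lemma mult_less_kappa_E1_E2:
  assumes B: "\<bar>B\<bar> < 1" and E: "(A, B) \<in> E1 \<union> E2" and t: "0 \<le> t" "t \<le> 1"
  shows "\<bar>B\<bar> * t < kappa \<bar>A + B\<bar> t"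
  using E
proof
  assume "(A, B) \<in> E1"
  then have "\<bar>\<bar>A + B\<bar> - 1\<bar> < sqrt (1 - B\<^sup>2)"
    by (auto simp: E1_def)
  then have "\<bar>\<bar>A + B\<bar> - 1\<bar>\<^sup>2 < (sqrt (1 - B\<^sup>2))\<^sup>2"
    by (intro power_strict_mono) auto
  moreover have "B\<^sup>2 \<le> 1"
    using B by (simp add: abs_square_le_1)
  ultimately have "0 < (1 - \<bar>B\<bar>\<^sup>2) - (\<bar>A + B\<bar> - 1)\<^sup>2"
    by simp
  also have "\<dots> = \<bar>A + B\<bar> * (2 - \<bar>A + B\<bar>) - \<bar>B\<bar>\<^sup>2"
    by algebra
  finally have "\<bar>B\<bar>\<^sup>2 < \<bar>A + B\<bar> * (2 - \<bar>A + B\<bar>)"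
    by simp
  then show ?thesis
    by (rule mult_less_kappa_of_discriminant)
next
  assume "(A, B) \<in> E2"
  then show ?thesis
    using B t by (intro mult_less_kappa_of_le) (auto simp: E2_def)
qed

text \<open>For \<open>c = 2 m\<close> the hypothesis on \<open>b\<close> makes \<open>\<kappa> - b r\<close> equal to \<open>m (r - b / (2 m))\<^sup>2\<close>.\<close>

lemma pick_inequality_of_discriminant_eq_0:
  fixes b m r s :: real
  assumes b: "0 \<le> b" "b\<^sup>2 = 4 * m * (1 - m)" and m: "0 < m"
    and r: "0 \<le> r" "r \<le> 1" and s: "0 \<le> s" "s \<le> 1"
  shows "m * (1 - r\<^sup>2) * (1 - s\<^sup>2) \<le> (1 - b * r * s)\<^sup>2 - (m * (1 - r\<^sup>2) * s)\<^sup>2"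
proof -
  define k where "k = kappa (2 * m) r"
  have k: "k = 1 - m * (1 - r\<^sup>2)"
    by (simp add: k_def kappa_def)
  have k_le: "k \<le> 1"
    using m r by (simp add: k_def kappa_le_1)
  have "4 * m * (k - b * r) = (2 * m * r - b)\<^sup>2"
    unfolding power2_diff b(2) k by (simp add: power2_eq_square algebra_simps)
  then have "0 \<le> 4 * m * (k - b * r)"
    by simp
  then have br_le_k: "b * r \<le> k"
    using m by (simp add: zero_le_mult_iff)
  have br_nonneg: "0 \<le> b * r"
    using b r by simp
  then have "(k + b * r) * s \<le> 2 * 1"
    using br_le_k k_le s by (intro mult_mono) auto
  then have "0 \<le> k * (1 - s)\<^sup>2 + (k - b * r) * s * (2 - (k + b * r) * s)"
    using br_le_k br_nonneg s by (intro add_nonneg_nonneg mult_nonneg_nonneg) auto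
  also have "\<dots> = (1 - b * r * s)\<^sup>2 - (m * (1 - r\<^sup>2) * s)\<^sup>2 - m * (1 - r\<^sup>2) * (1 - s\<^sup>2)"
    unfolding k by algebra
  finally show ?thesis
    by simp
qed

lemma pick_majorant_le_of_large:
  fixes b c r s :: real
  assumes b: "0 \<le> b" "b \<le> 1" and r: "0 \<le> r" "r < 1" and s: "0 \<le> s" "s \<le> 1"
  defines "w \<equiv> sqrt (1 - b\<^sup>2)"
  assumes c: "1 + w \<le> c"
  shows "pick_majorant c b r s \<le> 2 * c / (1 + w)\<^sup>2"
proof -
  define m u where "m = (1 + w) / 2" and "u = 1 - r\<^sup>2"
  have "0 \<le> w" "w\<^sup>2 = 1 - b\<^sup>2"
    using b by (simp_all add: w_def abs_square_le_1)
  then have m: "0 < m" "2 * m \<le> c" "b\<^sup>2 = 4 * m * (1 - m)"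
    using c by (simp_all add: m_def power2_eq_square field_simps)
  have u: "0 \<le> u" and s_nonneg: "0 \<le> 1 - s\<^sup>2"
    using r s by (simp_all add: u_def abs_square_le_1)
  have "m * u * (1 - s\<^sup>2) \<le> (1 - b * r * s)\<^sup>2 - (m * u * s)\<^sup>2"
    unfolding u_def using b(1) m r s by (intro pick_inequality_of_discriminant_eq_0) auto
  then have "2 * m * (m * u * (1 - s\<^sup>2)) \<le> c * ((1 - b * r * s)\<^sup>2 - (m * u * s)\<^sup>2)"
    using m u s_nonneg by (intro mult_mono) auto
  moreover have kappa: "1 - kappa c r * s\<^sup>2 = 1 - s\<^sup>2 + c * u * s\<^sup>2 / 2"
    by (simp add: kappa_def u_def field_simps)
  ultimately have "2 * m\<^sup>2 * (u * (1 - kappa c r * s\<^sup>2)) \<le> c * (1 - b * r * s)\<^sup>2"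
    unfolding kappa by (simp add: power2_eq_square algebra_simps)
  then have "pick_majorant c b r s \<le> c / (2 * m\<^sup>2)"
    using pick_denominator_pos[OF b r s] m
    by (simp add: pick_majorant_def u_def divide_le_eq le_divide_eq mult_ac)
  also have "c / (2 * m\<^sup>2) = 2 * c / (1 + w)\<^sup>2"
    by (simp add: m_def power_divide)
  finally show ?thesis .
qed

lemma pick_majorant_at_1:
  fixes b c :: real
  assumes b: "\<bar>b\<bar> < 1"
  defines "w \<equiv> sqrt (1 - b\<^sup>2)"
  shows "pick_majorant c b (b / (1 + w)) 1 = 2 * c / (1 + w)\<^sup>2"
proof -
  define r where "r = b / (1 + w)"
  have w: "0 < w"
    using b by (simp add: w_def abs_square_less_1)
  have "w\<^sup>2 = 1 - b\<^sup>2"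
    using b by (simp add: w_def abs_square_le_1)
  then have b_square: "b * b = (1 - w) * (1 + w)"
    by (simp add: power2_eq_square algebra_simps)
  have "1 - b * r = w"
    using w by (simp add: r_def b_square)
  moreover have "1 - r\<^sup>2 = 2 * w / (1 + w)"
  proof -
    have "r\<^sup>2 = (1 - w) / (1 + w)"
      using w by (simp add: r_def power2_eq_square b_square)
    then show ?thesis
      using w by (simp add: field_simps)
  qed
  ultimately show ?thesis
    using w by (simp add: pick_majorant_def kappa_def power2_eq_square flip: r_def)
qed

section \<open>The sharp estimates\<close>

lemma gamma_fun_le_bound12:
  assumes AB: "-1 \<le> B" "B < A" "A \<le> 1" and r: "0 \<le> r" "r < 1"
  shows "(A - B) * gamma_fun A B r \<le> bound12 A B"
proof -
  have B: "\<bar>B\<bar> \<le> 1" and c: "\<bar>A + B\<bar> < 2" and r_less: "\<bar>r\<bar> < 1"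
    using AB r by auto
  consider "B = -1" | "B \<noteq> -1" "\<bar>A + B\<bar> \<le> 2 * (1 - B\<^sup>2)" | "B \<noteq> -1" "2 * (1 - B\<^sup>2) < \<bar>A + B\<bar>"
    by linarith
  then show ?thesis
  proof cases
    case 1
    have "(A - B) * gamma_fun A B r = 2 * kappa (1 - A) r"
      using gamma_fun_minus_1[of A r] 1 AB r_less by simp
    also have "\<dots> \<le> 2"
      using kappa_le_1[of "1 - A" r] AB r_less by simp
    finally show ?thesis
      using 1 by (simp add: bound12_def)
  next
    case 2
    then show ?thesis
      using AB gamma_fun_le_1[OF c B r_less] by (simp add: bound12_def mult_left_le)
  next
    case 3
    then have B_less: "\<bar>B\<bar> < 1"
      using AB by auto
    have "gamma_fun A B r \<le> gamma_fun A B (alpha_root A B)"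
      using alpha_root_is_root[OF B_less c 3(2)] by (intro gamma_fun_le_critical[OF c B r_less]) auto
    then show ?thesis
      using 3 AB by (simp add: bound12_def)
  qed
qed

lemma schwarzian_norm_le_bound12:
  assumes AB: "-1 \<le> B" "B < A" "A \<le> 1" and f: "f \<in> class_C A B"
  shows "schwarzian_norm f \<le> ereal (bound12 A B)"
proof (rule schwarzian_norm_le_of_pick_majorant[OF f])
  show B: "\<bar>B\<bar> \<le> 1"
    using AB by auto
  fix r s :: real
  assume r: "0 \<le> r" "r < 1" and s: "0 \<le> s" "s \<le> 1"
  have c: "\<bar>A + B\<bar> < 2"
    using AB by auto
  have "\<bar>A - B\<bar> * pick_majorant \<bar>A + B\<bar> \<bar>B\<bar> r s \<le> (A - B) * gamma_fun A B r"
    using AB pick_majorant_le_gamma_fun[OF c B r s] by (simp add: mult_left_mono)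
  also have "\<dots> \<le> bound12 A B"
    using AB r by (rule gamma_fun_le_bound12)
  finally show "\<bar>A - B\<bar> * pick_majorant \<bar>A + B\<bar> \<bar>B\<bar> r s \<le> bound12 A B" .
qed

lemma bound12_eq_pick_majorant:
  assumes AB: "-1 < B" "B < A" "A \<le> 1" and E: "(A, B) \<in> E1 \<union> E2"
  obtains r s where "0 \<le> r" "r < 1" "0 \<le> s" "s \<le> 1"
    "bound12 A B = (A - B) * pick_majorant \<bar>A + B\<bar> \<bar>B\<bar> r s"
proof (cases "\<bar>A + B\<bar> \<le> 2 * (1 - B\<^sup>2)")
  case True
  then show ?thesis
    using AB by (intro that[of 0 0]) (simp_all add: bound12_def pick_majorant_def)
next
  case False
  have B: "\<bar>B\<bar> < 1" and c: "\<bar>A + B\<bar> < 2"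
    using AB by auto
  define t where "t = alpha_root A B"
  define s where "s = \<bar>B\<bar> * t / kappa \<bar>A + B\<bar> t"
  have t: "0 < t" "t < 1"
    using alpha_root_is_root[OF B c] False by (simp_all add: t_def)
  have "0 \<le> \<bar>B\<bar> * t" "\<bar>B\<bar> * t < kappa \<bar>A + B\<bar> t"
    using mult_less_kappa_E1_E2[OF B E, of t] t by simp_all
  then have s: "0 \<le> s" "s \<le> 1"
    by (simp_all add: s_def)
  have "pick_majorant \<bar>A + B\<bar> \<bar>B\<bar> t s = gamma_fun A B t"
    unfolding s_def using t B c by (intro pick_majorant_eq_gamma_fun square_mult_less_kappa) auto
  then show ?thesis
    using t s AB False by (intro that[of t s]) (auto simp: bound12_def t_def)
qed

lemma bound12_attained:
  assumes AB: "-1 \<le> B" "B < A" "A \<le> 1" and E: "(A, B) \<in> E1 \<union> E2"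
  shows "\<exists>f\<in>class_C A B. schwarzian_norm f = ereal (bound12 A B)"
proof -
  have "\<exists>f\<in>class_C A B. ereal (bound12 A B) \<le> schwarzian_norm f"
  proof (cases "B = -1")
    case True
    have A: "0 \<le> A"
      using E True AB by (auto simp: E1_def E2_def)
    have "2 * (1 + A) * (1 - A + 2 * A) = 2 * (1 + A)\<^sup>2"
      by (simp add: power2_eq_square algebra_simps)
    then have "2 * (1 + A) * (1 - A + 2 * A) / (1 + A)\<^sup>2 = bound12 A B"
      using True A by (simp only: bound12_def) simp
    then show ?thesis
      using schwarzian_norm_ge_affine_schur_parameter[of A A] A AB True by simp
  next
    case False
    then obtain r s where "0 \<le> r" "r < 1" "0 \<le> s" "s \<le> 1"
      and "bound12 A B = (A - B) * pick_majorant \<bar>A + B\<bar> \<bar>B\<bar> r s"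
      using bound12_eq_pick_majorant[of B A] AB E by auto
    then show ?thesis
      using pick_majorant_le_schwarzian_norm[of B r s A] AB by simp
  qed
  then show ?thesis
    using schwarzian_norm_le_bound12[OF AB] by (meson antisym)
qed

lemma E3_neq_0: "(A, B) \<in> E3 \<Longrightarrow> B \<noteq> 0"
  by (auto simp: E3_def E_def)

lemma bound3_eq:
  assumes "\<bar>B\<bar> \<le> 1" "B \<noteq> 0"
  shows "bound3 A B = \<bar>A - B\<bar> * (2 * \<bar>A + B\<bar> / (1 + sqrt (1 - B\<^sup>2))\<^sup>2)"
proof -
  define w where "w = sqrt (1 - B\<^sup>2)"
  have "w\<^sup>2 = 1 - B\<^sup>2"
    using assms by (simp add: w_def abs_square_le_1)
  then have B_square: "B\<^sup>2 = (1 - w) * (1 + w)"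
    by (simp add: power2_eq_square algebra_simps)
  then have "1 - w \<noteq> 0"
    using assms by auto
  moreover have "B ^ 4 = (1 - w)\<^sup>2 * (1 + w)\<^sup>2"
    by (metis B_square numeral_Bit0 power2_eq_square power_add power_mult_distrib)
  moreover have "\<bar>A\<^sup>2 - B\<^sup>2\<bar> = \<bar>A - B\<bar> * \<bar>A + B\<bar>"
    by (simp add: power2_eq_square square_diff_square_factored abs_mult mult.commute)
  ultimately show ?thesis
    by (simp add: bound3_def flip: w_def)
qed

lemma schwarzian_norm_le_bound3:
  assumes AB: "-1 \<le> B" "B < A" "A \<le> 1" and E: "(A, B) \<in> E3" and f: "f \<in> class_C A B"
  shows "schwarzian_norm f \<le> ereal (bound3 A B)"
proof (rule schwarzian_norm_le_of_pick_majorant[OF f])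
  show B: "\<bar>B\<bar> \<le> 1"
    using AB by auto
  fix r s :: real
  assume "0 \<le> r" "r < 1" "0 \<le> s" "s \<le> 1"
  then have "pick_majorant \<bar>A + B\<bar> \<bar>B\<bar> r s \<le> 2 * \<bar>A + B\<bar> / (1 + sqrt (1 - B\<^sup>2))\<^sup>2"
    using pick_majorant_le_of_large[of "\<bar>B\<bar>" r s "\<bar>A + B\<bar>"] B E by (simp add: E3_def)
  then show "\<bar>A - B\<bar> * pick_majorant \<bar>A + B\<bar> \<bar>B\<bar> r s \<le> bound3 A B"
    unfolding bound3_eq[OF B E3_neq_0[OF E]] by (rule mult_left_mono) simp
qed

lemma bound3_attained:
  assumes AB: "-1 \<le> B" "B < A" "A \<le> 1" and E: "(A, B) \<in> E3"
  shows "\<exists>f\<in>class_C A B. schwarzian_norm f = ereal (bound3 A B)"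
proof -
  have B: "\<bar>B\<bar> \<le> 1"
    using AB by auto
  note eq = bound3_eq[OF B E3_neq_0[OF E]]
  have "\<exists>f\<in>class_C A B. ereal (bound3 A B) \<le> schwarzian_norm f"
  proof (cases "B = -1")
    case True
    then have "2 * (1 + A) * (1 - A + 2 * 0) / (1 + 0)\<^sup>2 = bound3 A B"
      unfolding eq using AB by (simp add: algebra_simps)
    then show ?thesis
      using schwarzian_norm_ge_affine_schur_parameter[of A 0] AB True by simp
  next
    case False
    then have "\<bar>B\<bar> < 1"
      using AB by auto
    define r where "r = \<bar>B\<bar> / (1 + sqrt (1 - B\<^sup>2))"
    have "0 \<le> sqrt (1 - B\<^sup>2)"
      using B by (simp add: abs_square_le_1)
    then have "\<bar>B\<bar> < 1 + sqrt (1 - B\<^sup>2)"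
      using \<open>\<bar>B\<bar> < 1\<close> by linarith
    then have r: "0 \<le> r" "r < 1"
      by (simp_all add: r_def)
    have "bound3 A B = \<bar>A - B\<bar> * pick_majorant \<bar>A + B\<bar> \<bar>B\<bar> r 1"
      using pick_majorant_at_1[of "\<bar>B\<bar>" "\<bar>A + B\<bar>"] \<open>\<bar>B\<bar> < 1\<close> by (simp add: eq r_def)
    then show ?thesis
      using pick_majorant_le_schwarzian_norm[OF B r, of 1] by simp
  qed
  then show ?thesis
    using schwarzian_norm_le_bound3[OF AB E] by (meson antisym)
qed

theorem theorem2p2:
  fixes A B :: real
  assumes "-1 \<le> B" and "B < A" and "A \<le> 1"
  shows "((A,B) \<in> E1 \<union> E2 \<longrightarrow>
            ((B \<noteq> -1 \<and> \<bar>A+B\<bar> > 2*(1 - B^2)) \<longrightarrow>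
                 (\<exists>!t. 0 < t \<and> t < 1 \<and> h_poly A B t = 0)) \<and>
            (\<forall>f\<in>class_C A B. schwarzian_norm f \<le> ereal (bound12 A B)) \<and>
            (\<exists>f\<in>class_C A B. schwarzian_norm f = ereal (bound12 A B)))
       \<and> ((A,B) \<in> E3 \<longrightarrow>
            (\<forall>f\<in>class_C A B. schwarzian_norm f \<le> ereal (bound3 A B)) \<and>
            (\<exists>f\<in>class_C A B. schwarzian_norm f = ereal (bound3 A B)))"
proof -
  have "\<exists>!t. 0 < t \<and> t < 1 \<and> h_poly A B t = 0" if "B \<noteq> -1" "\<bar>A+B\<bar> > 2*(1 - B^2)"
    using assms that by (intro h_poly_unique_root) auto
  then show ?thesis
    using schwarzian_norm_le_bound12[OF assms] bound12_attained[OF assms]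
      schwarzian_norm_le_bound3[OF assms] bound3_attained[OF assms]
    by blast
qed

end
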